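(* Let $P$ and $P'$ be polyhedra each obtained from a box by a set of intrusions in one face (the box, the face, and the intrusions may a priori differ between $P$ and $P'$). If a finite set $M$ of point-normal markers is a marker-per-face markup of both $P$ and $P'$, then $P=P'$.
   Context: A box is a set $B=[a_1,b_1]\times[a_2,b_2]\times[a_3,b_3]$ with $a_i<b_i$. Let $F$ be a face of $B$, $n$ its outward unit normal, and $h$ the width of $B$ in the direction $n$. A polyhedron obtained from $B$ by a set of intrusions in the face $F$ is a set $P=\overline{B\setminus\bigcup_{j=1}^m K_j}$ where $r_1,\dots,r_m$ are pairwise disjoint closed rectangles contained in the relative interior of $F$ with sides parallel to the sides of $F$, $0<d_j\le h$, and $K_j=\{x-tn: x\in r_j,\ 0\le t\le d_j\}$ (if $d_j=h$ the intrusion goes all the way through $B$). Faces of a polyhedron $P$ are taken maximal: the closures of the connected components of the set of points of $\partial P$ having a neighbourhood in $\partial P$ contained in a single plane. A point-normal marker is a pair $(p,n)$ with $p\in\mathbb{R}^3$ and $n$ a unit vector; a finite set $M$ of them is a marker-per-face markup of $P$ if each $(p,n)\in M$ has $p$ on a face $F$ of $P$ with $n$ the outward unit normal of $P$ on $F$, and every face $F$ of $P$ contains the point of some marker in $M$ whose vector is the outward unit normal of $F$. *)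

theory Defs
  imports "HOL-Analysis.Analysis"
begin

type_synonym pt = "real^3"

text \<open>Outward unit normal of the box face (axis i, upper face if s, lower face otherwise).\<close>
definition face_normal :: "3 \<Rightarrow> bool \<Rightarrow> pt" where
  "face_normal i s = (if s then 1 else -1) *\<^sub>R axis i (1::real)"

definition face_level :: "pt \<Rightarrow> pt \<Rightarrow> 3 \<Rightarrow> bool \<Rightarrow> real" where
  "face_level a b i s = (if s then b $ i else a $ i)"

definition face_rect :: "pt \<Rightarrow> pt \<Rightarrow> 3 \<Rightarrow> bool \<Rightarrow> pt \<Rightarrow> pt \<Rightarrow> pt set" where
  "face_rect a b i s c d =
     {x. x $ i = face_level a b i s \<and> (\<forall>k. k \<noteq> i \<longrightarrow> c $ k \<le> x $ k \<and> x $ k \<le> d $ k)}"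

definition intrusion :: "pt \<Rightarrow> pt \<Rightarrow> 3 \<Rightarrow> bool \<Rightarrow> pt \<Rightarrow> pt \<Rightarrow> real \<Rightarrow> pt set" where
  "intrusion a b i s c d dep =
     {x - t *\<^sub>R face_normal i s | x t. x \<in> face_rect a b i s c d \<and> 0 \<le> t \<and> t \<le> dep}"

definition intrusion_polyhedron :: "pt set \<Rightarrow> bool" where
  "intrusion_polyhedron P \<longleftrightarrow>
     (\<exists>(a::pt) (b::pt) (i::3) (s::bool) (m::nat) (c::nat \<Rightarrow> pt) (d::nat \<Rightarrow> pt) (dep::nat \<Rightarrow> real).
        (\<forall>k. a $ k < b $ k) \<and>
        (\<forall>j<m. 0 < dep j \<and> dep j \<le> b $ i - a $ i \<and>
               (\<forall>k. k \<noteq> i \<longrightarrow> a $ k < c j $ k \<and> c j $ k < d j $ k \<and> d j $ k < b $ k)) \<and>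
        (\<forall>j<m. \<forall>l<m. j \<noteq> l \<longrightarrow>
               face_rect a b i s (c j) (d j) \<inter> face_rect a b i s (c l) (d l) = {}) \<and>
        P = closure (cbox a b - (\<Union>j<m. intrusion a b i s (c j) (d j) (dep j))))"

definition regular_boundary :: "pt set \<Rightarrow> pt set" where
  "regular_boundary P =
     {p \<in> frontier P. \<exists>U. open U \<and> p \<in> U \<and>
        (\<exists>(v::pt) (e::real). v \<noteq> 0 \<and> U \<inter> frontier P \<subseteq> {x. v \<bullet> x = e})}"

definition poly_faces :: "pt set \<Rightarrow> pt set set" where
  "poly_faces P = closure ` components (regular_boundary P)"

definition outward_normal :: "pt set \<Rightarrow> pt set \<Rightarrow> pt \<Rightarrow> bool" where
  "outward_normal P F n \<longleftrightarrow>
     norm n = 1 \<and> (\<exists>e. F \<subseteq> {x. n \<bullet> x = e}) \<and>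
     (\<exists>C \<in> components (regular_boundary P). F = closure C \<and>
        (\<forall>p\<in>C. \<exists>\<epsilon>>0. \<forall>t. 0 < t \<and> t < \<epsilon> \<longrightarrow> p + t *\<^sub>R n \<notin> P))"

definition marker_per_face_markup :: "pt set \<Rightarrow> (pt \<times> pt) set \<Rightarrow> bool" where
  "marker_per_face_markup P M \<longleftrightarrow>
     finite M \<and>
     (\<forall>(p, n) \<in> M. \<exists>F \<in> poly_faces P. p \<in> F \<and> outward_normal P F n) \<and>
     (\<forall>F \<in> poly_faces P. \<exists>(p, n) \<in> M. p \<in> F \<and> outward_normal P F n)"

end

theory Submission
  imports Defs
begin

text \<open>
  Treating every intrusion as a closed box inside the outer box \<open>B\<close> puts walls and floors on the
  same footing: each pocket side not lying in the boundary of \<open>B\<close> exposes one rectangle. Near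
  any of its points the boundary of \<open>P\<close> contains a rectangle parallel to two axes, so normals of
  faces are \<open>\<plusminus>e\<^sub>k\<close>, and a face with normal \<open>\<plusminus>e\<^sub>k\<close> lies in an outer face or, by connectedness,
  in a single pocket side. Hence the extreme marker levels determine \<open>B\<close>, and markers at
  intermediate levels occur for both signs exactly on the two axes orthogonal to the direction of
  the intrusions.

  Projecting the wall markers along that direction leaves a planar problem: disjoint rectangles
  with a marker on each side. Discarding the rectangles common to both families, look at the lowest
  left-side marker of minimal abscissa; the rectangles of the two families through it
  must share first their lower, then their upper, then their right side, since any discrepancy
  forces a marker into a rectangle away from the proper side. Finally a floor marker lies above the
  rectangle of its own pocket only, which recovers the depth.
\<close>

subsection \<open>Disjoint planar rectangles with a marker on each side\<close>

type_synonym rect = "(real \<times> real) \<times> (real \<times> real)"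

definition in_rect :: "real \<times> real \<Rightarrow> rect \<Rightarrow> bool" where
  "in_rect = (\<lambda>(x, y) ((l, r), (b, t)). l \<le> x \<and> x \<le> r \<and> b \<le> y \<and> y \<le> t)"

text \<open>One predicate serves all four sides: \<open>lev\<close> reads the level of a side off a
  rectangle, \<open>crd\<close> selects the marker coordinate to be compared with it.\<close>

definition marks ::
  "(rect \<Rightarrow> real) \<Rightarrow> (real \<times> real \<Rightarrow> real) \<Rightarrow> (real \<times> real) set \<Rightarrow> rect set \<Rightarrow> bool" where
  "marks lev crd W R \<longleftrightarrow>
     (\<forall>w\<in>W. \<exists>r\<in>R. in_rect w r \<and> crd w = lev r) \<and>
     (\<forall>r\<in>R. \<exists>w\<in>W. in_rect w r \<and> crd w = lev r)"

text \<open>The rectangle \<open>((l, r), (b, t))\<close> is \<open>[l, r] \<times> [b, t]\<close>; \<open>W\<close>, \<open>E\<close>, \<open>S\<close>, \<open>N\<close> are the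
  marker positions on left, right, bottom and top sides.\<close>
definition rect_markup ::
  "(real \<times> real) set \<Rightarrow> (real \<times> real) set \<Rightarrow> (real \<times> real) set \<Rightarrow> (real \<times> real) set \<Rightarrow> rect set \<Rightarrow> bool" where
  "rect_markup W E S N R \<longleftrightarrow>
     (\<forall>q\<in>R. \<forall>r\<in>R. q \<noteq> r \<longrightarrow> \<not> (\<exists>w. in_rect w q \<and> in_rect w r)) \<and>
     marks (fst \<circ> fst) fst W R \<and> marks (snd \<circ> fst) fst E R \<and>
     marks (fst \<circ> snd) snd S R \<and> marks (snd \<circ> snd) snd N R"

lemma in_rect_simp [simp]:
  "in_rect (x, y) ((l, r), (b, t)) \<longleftrightarrow> l \<le> x \<and> x \<le> r \<and> b \<le> y \<and> y \<le> t"
  by (simp add: in_rect_def)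

lemma rect_markup_unique:
  assumes "rect_markup W E S N R" "q \<in> R" "r \<in> R" "in_rect w q" "in_rect w r"
  shows "q = r"
  using assms unfolding rect_markup_def by blast

text \<open>The marker lies on the proper side of some rectangle, and by disjointness that rectangle
  is the given one. The comparisons below contradict this by finding a marker in a rectangle but off
  the proper side.\<close>

lemma rect_markup_on:
  assumes "rect_markup W E S N R" "((l, r), (b, t)) \<in> R" "in_rect (x, y) ((l, r), (b, t))"
  shows "(x, y) \<in> W \<Longrightarrow> x = l" "(x, y) \<in> E \<Longrightarrow> x = r"
        "(x, y) \<in> S \<Longrightarrow> y = b" "(x, y) \<in> N \<Longrightarrow> y = t"
proof -
  have *: "crd (x, y) = lev ((l, r), (b, t))" if "marks lev crd Z R" "(x, y) \<in> Z" for lev crd Z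
    using that rect_markup_unique[OF assms(1,2) _ assms(3)] unfolding marks_def by metis
  show "(x, y) \<in> W \<Longrightarrow> x = l" "(x, y) \<in> E \<Longrightarrow> x = r"
        "(x, y) \<in> S \<Longrightarrow> y = b" "(x, y) \<in> N \<Longrightarrow> y = t"
    using assms(1) *[of "fst \<circ> fst" fst W] *[of "snd \<circ> fst" fst E] *[of "fst \<circ> snd" snd S]
      *[of "snd \<circ> snd" snd N] unfolding rect_markup_def by auto
qed

lemma rect_markup_rect:
  assumes "rect_markup W E S N R"
  shows "(x, y) \<in> W \<Longrightarrow> \<exists>r b t. ((x, r), (b, t)) \<in> R \<and> x \<le> r \<and> b \<le> y \<and> y \<le> t"
    and "(x, y) \<in> E \<Longrightarrow> \<exists>l b t. ((l, x), (b, t)) \<in> R \<and> l \<le> x \<and> b \<le> y \<and> y \<le> t"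
    and "(x, y) \<in> S \<Longrightarrow> \<exists>l r t. ((l, r), (y, t)) \<in> R \<and> l \<le> x \<and> x \<le> r \<and> y \<le> t"
    and "(x, y) \<in> N \<Longrightarrow> \<exists>l r b. ((l, r), (b, y)) \<in> R \<and> l \<le> x \<and> x \<le> r \<and> b \<le> y"
  using assms unfolding rect_markup_def marks_def by fastforce+

lemma rect_markup_marker:
  assumes "rect_markup W E S N R" "((l, r), (b, t)) \<in> R"
  shows "\<exists>y. (l, y) \<in> W \<and> b \<le> y \<and> y \<le> t" "\<exists>y. (r, y) \<in> E \<and> b \<le> y \<and> y \<le> t"
    "\<exists>x. (x, b) \<in> S \<and> l \<le> x \<and> x \<le> r" "\<exists>x. (x, t) \<in> N \<and> l \<le> x \<and> x \<le> r"
  using assms unfolding rect_markup_def marks_def by fastforce+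

section \<open>Comparing the two rectangles at the lowest leftmost marker\<close>

text \<open>If \<open>u < u'\<close>, some rectangle of \<open>R'\<close> has bottom
  \<open>u\<close> and is squeezed below level \<open>u'\<close>; its left marker then has abscissa
  \<open>x0\<close> and lies below \<open>y0\<close>, against the choice of
  \<open>y0\<close>.\<close>

lemma first_rect_bottom_le:
  assumes R: "rect_markup W E S N R" and R': "rect_markup W E S N R'"
    and x0: "\<And>x y. (x, y) \<in> W \<Longrightarrow> x0 \<le> x"
    and y0: "\<And>y. (x0, y) \<in> W \<Longrightarrow> y0 \<le> y"
    and r: "((x0, w), (u, v)) \<in> R" "x0 \<le> w" "u \<le> y0" "y0 \<le> v"
    and r': "((x0, w'), (u', v')) \<in> R'" "x0 \<le> w'" "u' \<le> y0" "y0 \<le> v'"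
  shows "u' \<le> u"
proof (rule ccontr)
  assume "\<not> u' \<le> u"
  then have uu: "u < u'" by simp
  obtain x where x: "(x, u') \<in> S" "x0 \<le> x" "x \<le> w'"
    using rect_markup_marker(3)[OF R' r'(1)] by auto
  \<comment> \<open>At height \<open>u'\<close>, strictly above the bottom \<open>u\<close> and not
    above \<open>v\<close>, a bottom marker cannot lie in the rectangle of \<open>R\<close>, so it
    lies to the right of it.\<close>
  have "w < x"
    using rect_markup_on(3)[OF R r(1) _ x(1)] x(2) r r' uu by force
  obtain z where z: "(z, u) \<in> S" "x0 \<le> z" "z \<le> w"
    using rect_markup_marker(3)[OF R r(1)] by auto
  obtain p q t where k: "((p, q), (u, t)) \<in> R'" "p \<le> z" "z \<le> q" "u \<le> t"
    using rect_markup_rect(3)[OF R' z(1)] by auto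
  \<comment> \<open>A taller rectangle would share the point \<open>(z, u')\<close> with the first
    rectangle of \<open>R'\<close>, since \<open>z \<le> w < x \<le> w'\<close>.\<close>
  have "t < u'"
  proof (rule ccontr)
    assume "\<not> t < u'"
    then have "((p, q), (u, t)) = ((x0, w'), (u', v'))"
      using rect_markup_unique[OF R' k(1) r'(1), of "(z, u')"] k z x \<open>w < x\<close> uu r' by auto
    with uu show False by simp
  qed
  obtain y where y: "(p, y) \<in> W" "u \<le> y" "y \<le> t"
    using rect_markup_marker(1)[OF R' k(1)] by auto
  \<comment> \<open>The left marker of the squeezed rectangle lies in the first rectangle of
    \<open>R\<close>, hence on its left side.\<close>
  have "p = x0"
    using rect_markup_on(1)[OF R r(1) _ y(1)] y x0[OF y(1)] k z \<open>t < u'\<close> r r' by force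
  with y0 y \<open>t < u'\<close> r' show False by force
qed

text \<open>If \<open>v < v'\<close>, the rectangle of \<open>R'\<close> is taller but narrower. Its
  right marker then lies above the rectangle of \<open>R\<close> and belongs to a further rectangle
  of \<open>R\<close> that starts above \<open>v\<close>; the bottom marker of that one lies in the
  rectangle of \<open>R'\<close> above its bottom.\<close>

lemma first_rect_top_le:
  assumes R: "rect_markup W E S N R" and R': "rect_markup W E S N R'"
    and x0: "\<And>x y. (x, y) \<in> W \<Longrightarrow> x0 \<le> x"
    and r: "((x0, w), (u, v)) \<in> R" "x0 \<le> w" "u \<le> v"
    and r': "((x0, w'), (u, v')) \<in> R'" "x0 \<le> w'" "u \<le> v'"
  shows "v' \<le> v"
proof (rule ccontr)
  assume "\<not> v' \<le> v"
  then have vv: "v < v'" by simp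
  obtain x where x: "(x, v) \<in> N" "x0 \<le> x" "x \<le> w"
    using rect_markup_marker(4)[OF R r(1)] by auto
  \<comment> \<open>Otherwise this top marker would lie in the rectangle of \<open>R'\<close>
    strictly below its top.\<close>
  have wx: "w' < x"
    using rect_markup_on(4)[OF R' r'(1) _ x(1)] x r vv by force
  obtain y where y: "(w', y) \<in> E" "u \<le> y" "y \<le> v'"
    using rect_markup_marker(2)[OF R' r'(1)] by auto
  \<comment> \<open>Otherwise this right marker would lie in the rectangle of \<open>R\<close>
    strictly left of its right side.\<close>
  have vy: "v < y"
    using rect_markup_on(2)[OF R r(1) _ y(1)] y r r' wx x by force
  obtain l b t where k: "((l, w'), (b, t)) \<in> R" "l \<le> w'" "b \<le> y" "y \<le> t"
    using rect_markup_rect(2)[OF R y(1)] by auto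
  have vb: "v < b"
  proof (rule ccontr)
    assume "\<not> v < b"
    then have "((l, w'), (b, t)) = ((x0, w), (u, v))"
      using rect_markup_unique[OF R k(1) r(1), of "(w', v)"] k r r' wx x vy by auto
    with wx x show False by simp
  qed
  have "x0 \<le> l" using rect_markup_marker(1)[OF R k(1)] x0 by auto
  obtain z where z: "(z, b) \<in> S" "l \<le> z" "z \<le> w'"
    using rect_markup_marker(3)[OF R k(1)] by auto
  have "b = u"
    using rect_markup_on(3)[OF R' r'(1) _ z(1)] z \<open>x0 \<le> l\<close> vb r y k by force
  with vb r show False by simp
qed

text \<open>The right marker of the narrower rectangle would lie in the wider one, off its right
  side.\<close>

lemma first_rect_right_le:
  assumes R: "rect_markup W E S N R" and R': "rect_markup W E S N R'"
    and r: "((x0, w), (u, v)) \<in> R" "x0 \<le> w"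
    and r': "((x0, w'), (u, v)) \<in> R'"
  shows "w' \<le> w"
proof (rule ccontr)
  assume "\<not> w' \<le> w"
  moreover obtain y where y: "(w, y) \<in> E" "u \<le> y" "y \<le> v"
    using rect_markup_marker(2)[OF R r(1)] by auto
  ultimately show False
    using rect_markup_on(2)[OF R' r'(1) _ y(1)] r by force
qed

text \<open>The marker \<open>(x0, y0)\<close> is chosen from \<open>W\<close> alone, so it is the
  same for both families, and each inequality above also holds with the families exchanged.\<close>

lemma rect_markup_common:
  assumes R: "rect_markup W E S N R" and R': "rect_markup W E S N R'"
    and "finite W" "R \<noteq> {}"
  shows "R \<inter> R' \<noteq> {}"
proof -
  have "W \<noteq> {}" using assms unfolding rect_markup_def marks_def by blast
  define x0 where "x0 = Min (fst ` W)"
  have x0: "x0 \<le> x" if "(x, y) \<in> W" for x y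
    unfolding x0_def using that \<open>finite W\<close> by (intro Min_le) force+
  have "x0 \<in> fst ` W" unfolding x0_def using \<open>finite W\<close> \<open>W \<noteq> {}\<close> by (intro Min_in) auto
  define Y where "Y = {y. (x0, y) \<in> W}"
  have "Y \<noteq> {}" using \<open>x0 \<in> fst ` W\<close> by (force simp: Y_def)
  have "finite Y" by (rule finite_subset[of _ "snd ` W"]) (use \<open>finite W\<close> in \<open>force simp: Y_def\<close>)+
  define y0 where "y0 = Min Y"
  have y0: "y0 \<le> y" if "(x0, y) \<in> W" for y
    unfolding y0_def using that \<open>finite Y\<close> by (intro Min_le) (auto simp: Y_def)
  have "(x0, y0) \<in> W" using Min_in[OF \<open>finite Y\<close> \<open>Y \<noteq> {}\<close>] by (auto simp: Y_def y0_def)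
  obtain w u v where r: "((x0, w), (u, v)) \<in> R" "x0 \<le> w" "u \<le> y0" "y0 \<le> v"
    using rect_markup_rect(1)[OF R \<open>(x0, y0) \<in> W\<close>] by auto
  obtain w' u' v' where r': "((x0, w'), (u', v')) \<in> R'" "x0 \<le> w'" "u' \<le> y0" "y0 \<le> v'"
    using rect_markup_rect(1)[OF R' \<open>(x0, y0) \<in> W\<close>] by auto
  have "u = u'"
    using first_rect_bottom_le[OF R R' x0 y0 r r'] first_rect_bottom_le[OF R' R x0 y0 r' r] by force
  moreover have "v = v'"
    using first_rect_top_le[OF R R' x0 r(1,2)] first_rect_top_le[OF R' R x0 r'(1,2)] r r'
      \<open>u = u'\<close> by force
  moreover have "w = w'"
    using first_rect_right_le[OF R R' r(1,2)] first_rect_right_le[OF R' R r'(1,2)] r r'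
      \<open>u = u'\<close> \<open>v = v'\<close> by force
  ultimately show ?thesis using r r' by auto
qed

section \<open>Discarding the rectangles common to both families\<close>

text \<open>A marker in a rectangle of \<open>R - R'\<close> also lies in some \<open>q\<close> of
  \<open>R'\<close>; if \<open>q\<close> were in \<open>R\<close>, disjointness would identify it
  with the former rectangle, which is not in \<open>R'\<close>. By symmetry both differences retain
  the same markers.\<close>

lemma marks_diff:
  assumes "rect_markup W E S N R" "rect_markup W E S N R'" "marks lev crd Z R" "marks lev crd Z R'"
  shows "marks lev crd {z \<in> Z. \<exists>r\<in>R - R'. in_rect z r} (R - R')"
    and "{z \<in> Z. \<exists>r\<in>R - R'. in_rect z r} \<subseteq> {z \<in> Z. \<exists>r\<in>R' - R. in_rect z r}"
proof -
  show "marks lev crd {z \<in> Z. \<exists>r\<in>R - R'. in_rect z r} (R - R')"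
    unfolding marks_def
  proof (intro conjI ballI)
    fix z assume "z \<in> {z \<in> Z. \<exists>r\<in>R - R'. in_rect z r}"
    then obtain r where r: "z \<in> Z" "r \<in> R - R'" "in_rect z r" by blast
    obtain q where q: "q \<in> R" "in_rect z q" "crd z = lev q"
      using assms(3) r unfolding marks_def by blast
    with r rect_markup_unique[OF assms(1) _ q(1) r(3) q(2)] have "q = r" by blast
    with q r show "\<exists>r\<in>R - R'. in_rect z r \<and> crd z = lev r" by blast
  next
    fix r assume "r \<in> R - R'"
    then show "\<exists>w\<in>{z \<in> Z. \<exists>r\<in>R - R'. in_rect z r}. in_rect w r \<and> crd w = lev r"
      using assms(3) unfolding marks_def by blast
  qed
  show "{z \<in> Z. \<exists>r\<in>R - R'. in_rect z r} \<subseteq> {z \<in> Z. \<exists>r\<in>R' - R. in_rect z r}"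
  proof clarify
    fix x y r assume z: "(x, y) \<in> Z" "r \<in> R" "r \<notin> R'" "in_rect (x, y) r"
    obtain q where q: "q \<in> R'" "in_rect (x, y) q"
      using assms(4) z unfolding marks_def by blast
    have "q \<notin> R"
      using rect_markup_unique[OF assms(1) z(2) _ z(4) q(2)] q z by blast
    with q show "\<exists>r\<in>R' - R. in_rect (x, y) r" by blast
  qed
qed

lemma rect_markup_diff:
  assumes R: "rect_markup W E S N R" and R': "rect_markup W E S N R'"
  defines "f \<equiv> \<lambda>Z. {z \<in> Z. \<exists>r\<in>R - R'. in_rect z r}"
  shows "rect_markup (f W) (f E) (f S) (f N) (R - R')"
    and "rect_markup (f W) (f E) (f S) (f N) (R' - R)"
proof -
  have 1: "marks lev crd (f Z) (R - R') \<and> marks lev crd (f Z) (R' - R)"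
    if "marks lev crd Z R" "marks lev crd Z R'" for lev crd Z
  proof -
    have "f Z = {z \<in> Z. \<exists>r\<in>R' - R. in_rect z r}"
      unfolding f_def by (rule equalityI[OF marks_diff(2)[OF R R' that] marks_diff(2)[OF R' R that(2,1)]])
    then show ?thesis
      using marks_diff(1)[OF R R' that] marks_diff(1)[OF R' R that(2,1)] by (simp add: f_def)
  qed
  show "rect_markup (f W) (f E) (f S) (f N) (R - R')"
    "rect_markup (f W) (f E) (f S) (f N) (R' - R)"
    using R R' 1 unfolding rect_markup_def by (blast, blast)
qed

text \<open>The differences \<open>R - R'\<close> and \<open>R' - R\<close> again have a common
  markup, so if the first were nonempty they would share a rectangle.\<close>

lemma rect_markup_subset:
  assumes R: "rect_markup W E S N R" and R': "rect_markup W E S N R'" and "finite W"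
  shows "R \<subseteq> R'"
proof (rule ccontr)
  assume "\<not> R \<subseteq> R'"
  then have "(R - R') \<inter> (R' - R) \<noteq> {}"
    by (intro rect_markup_common[OF rect_markup_diff[OF R R']]) (use \<open>finite W\<close> in auto)
  then show False by blast
qed

subsection \<open>The boundary of a box with disjoint pockets\<close>

lemma closure_along:
  fixes x w :: pt
  assumes "\<forall>\<^sub>F t in at_right (0::real). x + t *\<^sub>R w \<in> A"
  shows "x \<in> closure A"
proof -
  have "((\<lambda>t. x + t *\<^sub>R w) \<longlongrightarrow> x + 0 *\<^sub>R w) (at_right 0)"
    by (intro tendsto_intros)
  then have "((\<lambda>t. x + t *\<^sub>R w) \<longlongrightarrow> x) (at_right 0)" by simp
  moreover have "\<forall>\<^sub>F t in at_right 0. x + t *\<^sub>R w \<in> closure A"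
    using assms by (rule eventually_mono) (rule subsetD[OF closure_subset])
  ultimately show ?thesis
    by (intro Lim_in_closed_set[of "closure A" _ "at_right 0"]) auto
qed

lemma eventually_along:
  fixes x w :: pt
  assumes "open A" "x \<in> A"
  shows "\<forall>\<^sub>F t in at_right (0::real). x + t *\<^sub>R w \<in> A"
proof -
  have "((\<lambda>t. x + t *\<^sub>R w) \<longlongrightarrow> x + 0 *\<^sub>R w) (at_right 0)"
    by (intro tendsto_intros)
  then have "((\<lambda>t. x + t *\<^sub>R w) \<longlongrightarrow> x) (at_right 0)" by simp
  then show ?thesis
    by (rule topological_tendstoD[OF _ assms])
qed

lemma face_normal_nth: "face_normal k s $ l = (if l = k then (if s then 1 else -1) else 0)"
  by (auto simp: face_normal_def axis_def)

lemma eventually_right_less: "(0::real) < c \<Longrightarrow> \<forall>\<^sub>F t in at_right 0. t < c"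
  by (rule eventually_at_right_field[THEN iffD2]) auto

lemma face_normal_inj: "face_normal k s = face_normal l s' \<longleftrightarrow> k = l \<and> s = s'"
proof
  assume "face_normal k s = face_normal l s'"
  then have "face_normal k s $ k = face_normal l s' $ k" by simp
  then show "k = l \<and> s = s'" by (auto simp: face_normal_nth split: if_splits)
qed simp

lemma third_axis: "\<exists>l::3. l \<noteq> k \<and> l \<noteq> i"
proof -
  have "{k, i} \<noteq> UNIV"
  proof
    assume "{k, i} = UNIV"
    then have "card {k, i} = 3" by simp
    then show False by (simp add: card_insert_if split: if_splits)
  qed
  then show ?thesis by blast
qed

lemma other_axes_cases:
  assumes "k \<noteq> i" "l \<noteq> i" "k \<noteq> l" "c \<noteq> (i::3)"
  shows "c = k \<or> c = l"
proof -
  have "{k, l, i} = UNIV"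
    by (rule card_subset_eq) (use assms in auto)
  with assms(4) show ?thesis by blast
qed

text \<open>The bounds against \<open>a\<close> and \<open>b\<close> are weak so that a pocket may
  open onto a face of the box or pass through it.\<close>

locale carved_box =
  fixes a b :: pt and m :: nat and lo hi :: "nat \<Rightarrow> pt"
  assumes box: "a $ k < b $ k"
    and pocket: "j < m \<Longrightarrow> a $ k \<le> lo j $ k \<and> lo j $ k < hi j $ k \<and> hi j $ k \<le> b $ k"
    and disjoint: "\<lbrakk>j < m; l < m; x \<in> cbox (lo j) (hi j); x \<in> cbox (lo l) (hi l)\<rbrakk> \<Longrightarrow> j = l"
begin

definition body :: "pt set" where
  "body = closure (cbox a b - (\<Union>j<m. cbox (lo j) (hi j)))"

text \<open>Relative to the box, \<open>hollow j\<close> is the part of pocket \<open>j\<close> missing from \<open>body\<close>: the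
  closure restores the pocket sides, except those lying in the boundary of the box.\<close>
definition hollow :: "nat \<Rightarrow> pt set" where
  "hollow j = {x. \<forall>k. (lo j $ k < x $ k \<or> lo j $ k = a $ k) \<and> (x $ k < hi j $ k \<or> hi j $ k = b $ k)}"

definition outer_level :: "3 \<Rightarrow> bool \<Rightarrow> real" where
  "outer_level k s = (if s then b $ k else a $ k)"

definition inner_level :: "nat \<Rightarrow> 3 \<Rightarrow> bool \<Rightarrow> real" where
  "inner_level j k s = (if s then lo j $ k else hi j $ k)"

text \<open>The box has outward normal \<open>+e\<^sub>k\<close> on its upper side, a pocket exposes the normal \<open>+e\<^sub>k\<close>
  on its lower side.\<close>
definition flat :: "3 \<Rightarrow> bool \<Rightarrow> pt set" where
  "flat k s = {x \<in> cbox a b. x $ k = outer_level k s} \<union>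
     (\<Union>j\<in>{j. j < m \<and> inner_level j k s \<noteq> outer_level k (\<not> s)}.
        {x \<in> cbox (lo j) (hi j). x $ k = inner_level j k s})"

lemma pocket_subset: "j < m \<Longrightarrow> cbox (lo j) (hi j) \<subseteq> cbox a b"
  using pocket by (fastforce simp: mem_box_cart intro: order_trans)

lemma open_hollow: "open (hollow j)"
proof -
  have "hollow j = (\<Inter>k\<in>UNIV. ({x. lo j $ k < x $ k} \<union> {x. lo j $ k = a $ k}) \<inter>
                     ({x. x $ k < hi j $ k} \<union> {x. hi j $ k = b $ k}))"
    unfolding hollow_def by auto
  then show ?thesis
    by (auto intro!: open_INT open_Collect_less continuous_intros)
qed

lemma hollow_pocket: "x \<in> cbox a b \<Longrightarrow> x \<in> hollow j \<Longrightarrow> x \<in> cbox (lo j) (hi j)"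
  unfolding hollow_def mem_box_cart by (metis (mono_tags, lifting) less_imp_le mem_Collect_eq)

lemma box_hollow: "box (lo j) (hi j) \<subseteq> hollow j"
  unfolding hollow_def by (auto simp: mem_box_cart)

lemma eventually_axis_box:
  assumes x: "x \<in> cbox a b" "x $ k \<noteq> outer_level k s"
  shows "\<forall>\<^sub>F t in at_right 0. x + t *\<^sub>R face_normal k s \<in> cbox a b"
proof -
  define c where "c = (if s then b $ k - x $ k else x $ k - a $ k)"
  have "a $ k \<le> x $ k" "x $ k \<le> b $ k" using x by (auto simp: mem_box_cart)
  then have "0 < c" using x by (auto simp: c_def outer_level_def)
  from eventually_right_less[OF this] eventually_at_right_less[of 0] show ?thesis
  proof eventually_elim
    case (elim t)
    then show ?case using x
      by (auto simp: mem_box_cart face_normal_nth c_def split: if_splits)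
         (smt (verit, best))+
  qed
qed

section \<open>Points of the body and of its frontier\<close>

text \<open>One inclusion holds because the right side is closed, the hollows being open. For the
  other, a point of a pocket outside its hollow lies on an exposed side, and is a limit of points
  reached by stepping out of the pocket across that side.\<close>

lemma body_eq: "body = {x \<in> cbox a b. \<forall>j<m. x \<notin> hollow j}"
proof
  have "{x \<in> cbox a b. \<forall>j<m. x \<notin> hollow j} = cbox a b - (\<Union>j<m. hollow j)" by auto
  then have "closed {x \<in> cbox a b. \<forall>j<m. x \<notin> hollow j}"
    using open_hollow by (auto intro!: closed_Diff open_UN)
  then show "body \<subseteq> {x \<in> cbox a b. \<forall>j<m. x \<notin> hollow j}"
    unfolding body_def by (intro closure_minimal) (auto dest: hollow_pocket)
  show "{x \<in> cbox a b. \<forall>j<m. x \<notin> hollow j} \<subseteq> body"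
  proof clarify
    fix x assume x: "x \<in> cbox a b" "\<forall>j<m. x \<notin> hollow j"
    show "x \<in> body"
    proof (cases "\<exists>j<m. x \<in> cbox (lo j) (hi j)")
      case False
      then have "x \<in> cbox a b - (\<Union>j<m. cbox (lo j) (hi j))" using x by blast
      then show ?thesis unfolding body_def using closure_subset by (rule subsetD[rotated])
    next
      case True
      then obtain j where j: "j < m" "x \<in> cbox (lo j) (hi j)" by blast
      \<comment> \<open>The inequality says that this pocket side is not in the boundary of the box.
        The side exposes the normal \<open>face_normal k s\<close>, so the opposite direction leads
        into the solid.\<close>
      then obtain k s where ks: "x $ k = inner_level j k s" "inner_level j k s \<noteq> outer_level k (\<not> s)"
        using x(2) unfolding hollow_def mem_box_cart
        by (smt (verit, ccfv_SIG) inner_level_def outer_level_def mem_Collect_eq)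
      have 1: "\<forall>\<^sub>F t in at_right 0. x + t *\<^sub>R face_normal k (\<not> s) \<in> cbox a b"
        using ks x by (intro eventually_axis_box) auto
      have 2: "\<forall>\<^sub>F t in at_right 0. x + t *\<^sub>R face_normal k (\<not> s) \<notin> cbox (lo j) (hi j)"
        using eventually_at_right_less[of "0::real"]
      proof eventually_elim
        case (elim t)
        then show ?case using ks
          by (auto simp: mem_box_cart face_normal_nth inner_level_def split: if_splits intro!: exI[of _ k])
      qed
      have 3: "\<forall>\<^sub>F t in at_right 0. \<forall>l\<in>{l. l < m \<and> l \<noteq> j}. x + t *\<^sub>R face_normal k (\<not> s) \<in> - cbox (lo l) (hi l)"
        using j disjoint by (intro eventually_ball_finite ballI eventually_along) auto
      have "\<forall>\<^sub>F t in at_right 0. x + t *\<^sub>R face_normal k (\<not> s) \<in> cbox a b - (\<Union>j<m. cbox (lo j) (hi j))"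
        using 1 2 3 by eventually_elim auto
      then show ?thesis unfolding body_def by (rule closure_along)
    qed
  qed
qed

lemma closed_body: "closed body" unfolding body_def by simp

lemma frontier_subset_body: "frontier body \<subseteq> body"
  using closed_body by (simp add: frontier_subset_closed)

lemma frontier_cases:
  assumes "x \<in> frontier body"
  obtains (outer) k s where "x \<in> cbox a b" "x $ k = outer_level k s" "\<forall>j<m. x \<notin> cbox (lo j) (hi j)"
  | (inner) j k s where "j < m" "x \<in> cbox (lo j) (hi j)" "x $ k = inner_level j k s"
      "inner_level j k s \<noteq> outer_level k (\<not> s)"
proof -
  have x: "x \<in> cbox a b" "\<forall>j<m. x \<notin> hollow j"
    using assms frontier_subset_body body_eq by auto
  show ?thesis
  proof (cases "\<exists>j<m. x \<in> cbox (lo j) (hi j)")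
    case True
    then obtain j where j: "j < m" "x \<in> cbox (lo j) (hi j)" by blast
    then obtain k s where "x $ k = inner_level j k s" "inner_level j k s \<noteq> outer_level k (\<not> s)"
      using x(2) unfolding hollow_def mem_box_cart
      by (smt (verit, ccfv_SIG) inner_level_def outer_level_def mem_Collect_eq)
    with j show ?thesis by (rule inner)
  next
    case False
    define U where "U = box a b \<inter> - (\<Union>j<m. cbox (lo j) (hi j))"
    have "open U" unfolding U_def by (auto intro!: open_Int closed_UN)
    have "box a b \<subseteq> cbox a b" by (rule box_subset_cbox)
    then have "U \<subseteq> body"
      unfolding U_def body_def using closure_subset by fastforce
    then have "x \<notin> U" using assms \<open>open U\<close> by (metis Diff_iff frontier_def interiorI)
    then have "x \<notin> box a b" using False by (auto simp: U_def)
    then obtain k s where "x $ k = outer_level k s"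
      using x(1) unfolding mem_box_cart outer_level_def by (metis order_le_less)
    then show ?thesis using outer x False by blast
  qed
qed

lemma frontier_flat: "frontier body \<subseteq> (\<Union>k s. flat k s)"
proof
  fix x assume "x \<in> frontier body"
  then show "x \<in> (\<Union>k s. flat k s)"
    by (cases rule: frontier_cases) (auto simp: flat_def)
qed

lemma outer_frontier: "x \<in> body \<Longrightarrow> x $ k = outer_level k s \<Longrightarrow> x \<in> frontier body"
proof -
  assume x: "x \<in> body" "x $ k = outer_level k s"
  have "body \<subseteq> cbox a b" by (auto simp: body_eq)
  then have "interior body \<subseteq> box a b" using interior_mono interior_cbox by blast
  moreover have "x \<notin> box a b" using x by (cases s) (auto simp: mem_box_cart outer_level_def intro!: exI[of _ k])
  ultimately show ?thesis using x closed_body by (auto simp: frontier_def)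
qed

text \<open>The point is a limit of the open pocket, which misses the body, and the other pockets do
  not contain it.\<close>

lemma inner_frontier:
  assumes "j < m" "x \<in> cbox (lo j) (hi j)" "x $ k = inner_level j k s"
    "inner_level j k s \<noteq> outer_level k (\<not> s)"
  shows "x \<in> frontier body"
proof -
  have "x \<notin> hollow j"
    using assms(3,4) unfolding hollow_def
    by (auto simp: inner_level_def outer_level_def split: if_splits intro!: exI[of _ k])
  moreover have "x \<notin> hollow l" if "l < m" "l \<noteq> j" for l
    using that assms disjoint pocket_subset hollow_pocket by (metis subsetD)
  ultimately have "x \<in> body" using pocket_subset[OF assms(1)] assms(2) by (auto simp: body_eq)
  moreover have "x \<notin> interior body"
  proof
    assume "x \<in> interior body"
    have "box (lo j) (hi j) \<noteq> {}" using pocket[OF assms(1)] by (auto simp: interval_ne_empty_cart)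
    then have "x \<in> closure (box (lo j) (hi j))" using assms by (simp add: closure_box)
    then have "interior body \<inter> box (lo j) (hi j) \<noteq> {}"
      using \<open>x \<in> interior body\<close> open_Int_closure_eq_empty[OF open_interior] by blast
    then show False
      using box_hollow[of j] interior_subset[of body] assms(1) by (auto simp: body_eq)
  qed
  ultimately show ?thesis using closed_body by (simp add: frontier_def)
qed

text \<open>The point \<open>q\<close> may lie on an edge or at a corner of the rectangle; the part
  of the rectangle near \<open>q\<close> still spans both directions other than
  \<open>k\<close>.\<close>

lemma frontier_piece:
  assumes q: "q \<in> frontier body"
  obtains k u w e where "u $ k = q $ k" "w $ k = q $ k" "\<And>l. l \<noteq> k \<Longrightarrow> u $ l < w $ l"
    "q \<in> cbox u w" "0 < e" "cbox u w \<inter> ball q e \<subseteq> frontier body"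
  using q
proof (cases rule: frontier_cases)
  case (outer k s)
  \<comment> \<open>The rectangle is the whole face of the box; the ball keeps it away from the
    pockets.\<close>
  have "open (- (\<Union>j<m. cbox (lo j) (hi j)))" by (auto intro!: closed_UN)
  then obtain e where e: "0 < e" "ball q e \<subseteq> - (\<Union>j<m. cbox (lo j) (hi j))"
    using outer(3) by (metis (mono_tags, lifting) ComplI UN_E lessThan_iff openE)
  define u where "u = (\<chi> l. if l = k then q $ k else a $ l)"
  define w where "w = (\<chi> l. if l = k then q $ k else b $ l)"
  have uw: "x \<in> cbox a b \<and> x $ k = outer_level k s" if "x \<in> cbox u w" for x
  proof -
    have "u $ k \<le> x $ k \<and> x $ k \<le> w $ k" using that by (auto simp: mem_box_cart)
    then have "x $ k = q $ k" by (simp add: u_def w_def)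
    moreover have "a $ l \<le> x $ l \<and> x $ l \<le> b $ l" for l
      using that outer(1) \<open>x $ k = q $ k\<close> unfolding mem_box_cart u_def w_def
      by (cases "l = k") (auto dest: spec[of _ l])
    ultimately show ?thesis using outer(2) by (auto simp: mem_box_cart)
  qed
  show thesis
  proof (rule that[of u k w e])
    show "cbox u w \<inter> ball q e \<subseteq> frontier body"
    proof
      fix x assume x: "x \<in> cbox u w \<inter> ball q e"
      then have "x \<in> cbox a b - (\<Union>j<m. cbox (lo j) (hi j))" using uw e(2) by blast
      then have "x \<in> body" unfolding body_def using closure_subset by (rule subsetD[rotated])
      then show "x \<in> frontier body" using outer_frontier uw x by blast
    qed
  qed (use outer e box in \<open>auto simp: u_def w_def mem_box_cart\<close>)
next
  case (inner j k s)
  define u where "u = (\<chi> l. if l = k then q $ k else lo j $ l)"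
  define w where "w = (\<chi> l. if l = k then q $ k else hi j $ l)"
  \<comment> \<open>The whole pocket side lies in the frontier, so the radius is arbitrary.\<close>
  show thesis
  proof (rule that[of u k w 1])
    show "cbox u w \<inter> ball q 1 \<subseteq> frontier body"
    proof
      fix x assume x: "x \<in> cbox u w \<inter> ball q 1"
      then have "u $ k \<le> x $ k \<and> x $ k \<le> w $ k" by (auto simp: mem_box_cart)
      then have "x $ k = q $ k" by (simp add: u_def w_def)
      moreover have "lo j $ l \<le> x $ l \<and> x $ l \<le> hi j $ l" for l
      proof (cases "l = k")
        case True
        then show ?thesis using inner(2) \<open>x $ k = q $ k\<close> by (simp add: mem_box_cart)
      next
        case False
        have "u $ l \<le> x $ l \<and> x $ l \<le> w $ l" using x by (auto simp: mem_box_cart)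
        then show ?thesis using False by (simp add: u_def w_def)
      qed
      ultimately show "x \<in> frontier body"
        using inner by (intro inner_frontier[of j x k s]) (auto simp: mem_box_cart)
    qed
  qed (use inner pocket in \<open>auto simp: u_def w_def mem_box_cart\<close>)
qed

section \<open>Normals of faces and the flats containing them\<close>

lemma closed_flat: "closed (flat k s)"
proof -
  have c: "closed {x \<in> cbox u w. x $ k = e}" for u w :: pt and e
  proof -
    have "{x \<in> cbox u w. x $ k = e} = cbox u w \<inter> {x. x $ k = e}" by auto
    then show ?thesis by (auto intro!: closed_Int closed_Collect_eq continuous_intros)
  qed
  show ?thesis unfolding flat_def by (intro closed_Un closed_UN ballI c) auto
qed

text \<open>A small rectangular patch at \<open>q\<close> consists of regular points and is
  connected, so it lies in \<open>C\<close>. As \<open>n\<close> has constant inner product on the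
  patch, its components in the two directions of the patch vanish.\<close>

lemma component_normal:
  assumes C: "C \<in> components (regular_boundary body)" and q: "q \<in> C"
    and n: "norm n = 1" "C \<subseteq> {x. n \<bullet> x = e}"
  obtains k s where "n = face_normal k s"
proof -
  have "q \<in> regular_boundary body" using in_components_subset[OF C] q by blast
  then obtain U v e1 where U: "q \<in> frontier body" "open U" "q \<in> U" "v \<noteq> 0"
      "U \<inter> frontier body \<subseteq> {x. v \<bullet> x = e1}"
    unfolding regular_boundary_def by (elim CollectE conjE exE)
  obtain k u w r0 where
    k: "u $ k = q $ k" "w $ k = q $ k" "\<And>l. l \<noteq> k \<Longrightarrow> u $ l < w $ l"
    "q \<in> cbox u w" "0 < r0" "cbox u w \<inter> ball q r0 \<subseteq> frontier body"
    by (rule frontier_piece[OF U(1)]) (rule that)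
  obtain r1 where r1: "0 < r1" "ball q r1 \<subseteq> U" using U openE by blast
  define r where "r = min r0 r1"
  have r: "0 < r" "r \<le> r0" "r \<le> r1" using k r1 by (auto simp: r_def)
  define T where "T = cbox u w \<inter> ball q r"
  have "T \<subseteq> U \<inter> frontier body"
    using k(6) r1(2) r subset_ball[of r r0 q] subset_ball[of r r1 q] unfolding T_def by blast
  then have "T \<subseteq> regular_boundary body"
    using U unfolding regular_boundary_def by blast
  moreover have "connected T" unfolding T_def
    by (intro convex_connected convex_Int convex_box convex_ball)
  moreover have "q \<in> T" using k r by (auto simp: T_def)
  ultimately have "T \<subseteq> C" using components_maximal[OF C] q by blast
  have nl: "n $ l = 0" if "l \<noteq> k" for l
  proof -
    have ql: "u $ l \<le> q $ l" "q $ l \<le> w $ l" using k(4) by (auto simp: mem_box_cart)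
    \<comment> \<open>If \<open>q\<close> is on the upper edge in direction \<open>l\<close>, the
      step must go down; the strict inequality between the corners leaves room.\<close>
    define t where "t = (if q $ l < w $ l then min (r/2) (w $ l - q $ l) else - min (r/2) (w $ l - u $ l))"
    have t: "t \<noteq> 0" "\<bar>t\<bar> < r" "u $ l \<le> q $ l + t" "q $ l + t \<le> w $ l"
      using r ql k(3)[OF that] by (auto simp: t_def)
    have "q + t *\<^sub>R axis l 1 \<in> cbox u w"
      using k(4) t unfolding mem_box_cart by (auto simp: axis_def)
    moreover have "dist q (q + t *\<^sub>R axis l 1) < r" using t by (simp add: dist_norm)
    ultimately have "q + t *\<^sub>R axis l 1 \<in> C" using \<open>T \<subseteq> C\<close> by (auto simp: T_def)
    then have "n \<bullet> (q + t *\<^sub>R axis l 1) = n \<bullet> q" using n(2) q by auto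
    then show ?thesis using t by (simp add: inner_add_right inner_axis)
  qed
  then have nk: "n = n $ k *\<^sub>R axis k 1" by (auto simp: vec_eq_iff axis_def)
  then have "\<bar>n $ k\<bar> = 1" using n(1) by (metis mult.right_neutral norm_axis_1 norm_scaleR)
  then have "n = face_normal k (n $ k > 0)"
    by (subst nk) (auto simp: face_normal_def)
  then show thesis by (rule that)
qed

text \<open>The failure of a single clause of \<open>hollow\<close>: the side is exposed and
  \<open>x\<close> is on it or on its solid side.\<close>

definition blocked :: "nat \<Rightarrow> pt \<Rightarrow> 3 \<Rightarrow> bool \<Rightarrow> bool" where
  "blocked j x l s \<longleftrightarrow> inner_level j l s \<noteq> outer_level l (\<not> s) \<and>
     (if s then x $ l \<le> inner_level j l s else inner_level j l s \<le> x $ l)"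

lemma hollow_iff: "x \<in> hollow j \<longleftrightarrow> (\<forall>l s. \<not> blocked j x l s)"
  unfolding hollow_def blocked_def inner_level_def outer_level_def
  by (auto simp: all_bool_eq not_le not_less)

text \<open>Off \<open>flat k s\<close>, a short ray in the direction \<open>face_normal k s\<close>
  stays in the box, and each pocket keeps a clause that bars the ray from its hollow. The ray would
  then remain in the body.\<close>

lemma exposed_flat:
  assumes q: "q \<in> body" and e: "e > 0" "\<And>t. 0 < t \<Longrightarrow> t < e \<Longrightarrow> q + t *\<^sub>R face_normal k s \<notin> body"
  shows "q \<in> flat k s"
proof (rule ccontr)
  assume nf: "q \<notin> flat k s"
  have qB: "q \<in> cbox a b" and qh: "\<And>j. j < m \<Longrightarrow> q \<notin> hollow j" using q by (auto simp: body_eq)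
  have 1: "\<forall>\<^sub>F t in at_right 0. q + t *\<^sub>R face_normal k s \<in> cbox a b"
    using qB nf by (intro eventually_axis_box) (auto simp: flat_def)
  have 2: "\<forall>\<^sub>F t in at_right 0. q + t *\<^sub>R face_normal k s \<notin> hollow j" if j: "j < m" for j
  proof (cases "\<exists>l s'. (l, s') \<noteq> (k, s) \<and> blocked j q l s'")
    case True
    then obtain l s' where ls: "(l, s') \<noteq> (k, s)" "blocked j q l s'" by blast
    \<comment> \<open>A clause other than \<open>(k, s)\<close> persists: the ray changes only
      coordinate \<open>k\<close>, and moves away from the side that the clause
      \<open>(k, \<not> s)\<close> refers to.\<close>
    show ?thesis using eventually_at_right_less[of "0::real"]
    proof eventually_elim
      case (elim t)
      then have "blocked j (q + t *\<^sub>R face_normal k s) l s'"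
        using ls by (auto simp: blocked_def face_normal_nth)
      then show ?case by (auto simp: hollow_iff)
    qed
  next
    case False
    then have bk: "blocked j q k s" using qh[OF j] by (auto simp: hollow_iff)
    \<comment> \<open>With all other clauses satisfied, equality would place \<open>q\<close> in the
      closed pocket, on its exposed side, hence in \<open>flat k s\<close>. So there is a positive
      gap to cross before the clause \<open>(k, s)\<close> is lost.\<close>
    have "q $ k \<noteq> inner_level j k s"
    proof
      assume eq: "q $ k = inner_level j k s"
      have "lo j $ l \<le> q $ l \<and> q $ l \<le> hi j $ l" for l
      proof -
        have "lo j $ l \<le> q $ l"
        proof (cases "(l, True) = (k, s)")
          case True then show ?thesis using eq by (simp add: inner_level_def)
        next
          case F: False
          then have "\<not> blocked j q l True" using False by blast
          then show ?thesis using qB by (auto simp: blocked_def inner_level_def outer_level_def mem_box_cart)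
        qed
        moreover have "q $ l \<le> hi j $ l"
        proof (cases "(l, False) = (k, s)")
          case True then show ?thesis using eq by (simp add: inner_level_def)
        next
          case F: False
          then have "\<not> blocked j q l False" using False by blast
          then show ?thesis using qB by (auto simp: blocked_def inner_level_def outer_level_def mem_box_cart)
        qed
        ultimately show ?thesis by blast
      qed
      then show False using nf j eq bk by (auto simp: flat_def mem_box_cart blocked_def)
    qed
    then have "0 < \<bar>q $ k - inner_level j k s\<bar>" by simp
    from eventually_right_less[OF this] show ?thesis
    proof eventually_elim
      case (elim t)
      then have "blocked j (q + t *\<^sub>R face_normal k s) k s"
        using bk by (auto simp: blocked_def face_normal_nth)
      then show ?case by (auto simp: hollow_iff)
    qed
  qed
  have "\<forall>\<^sub>F t in at_right 0. \<forall>j\<in>{..<m}. q + t *\<^sub>R face_normal k s \<notin> hollow j"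
    using 2 by (intro eventually_ball_finite) auto
  with 1 eventually_right_less[OF e(1)] eventually_at_right_less[of "0::real"]
  have "\<forall>\<^sub>F t in at_right (0::real). False"
  proof eventually_elim
    case (elim t)
    then show ?case using e(2)[of t] by (auto simp: body_eq)
  qed
  then show False by (simp add: trivial_limit_at_right_real)
qed

lemma outward_normal_flat:
  assumes "outward_normal body F n"
  obtains k s where "n = face_normal k s" "F \<subseteq> flat k s"
proof -
  from assms obtain e C where C: "norm n = 1" "F \<subseteq> {x. n \<bullet> x = e}"
    "C \<in> components (regular_boundary body)" "F = closure C"
    and ex: "\<And>p. p \<in> C \<Longrightarrow> \<exists>\<epsilon>>0. \<forall>t. 0 < t \<and> t < \<epsilon> \<longrightarrow> p + t *\<^sub>R n \<notin> body"
    unfolding outward_normal_def by blast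
  have CF: "C \<subseteq> F" using C closure_subset by blast
  obtain q where q: "q \<in> C" using in_components_nonempty[OF C(3)] by blast
  have "C \<subseteq> {x. n \<bullet> x = e}" using CF C(2) by (rule subset_trans)
  then obtain k s where n: "n = face_normal k s"
    by (rule component_normal[OF C(3) q C(1)])
  have "C \<subseteq> flat k s"
  proof
    fix p assume p: "p \<in> C"
    then have "p \<in> body"
      using in_components_subset[OF C(3)] frontier_subset_body unfolding regular_boundary_def by blast
    then show "p \<in> flat k s" using ex[OF p] exposed_flat unfolding n by blast
  qed
  then have "F \<subseteq> flat k s" using C(4) closed_flat by (simp add: closure_minimal)
  with n show thesis by (rule that)
qed

lemma finite_levels: "finite ((\<lambda>x. x $ k) ` flat k s)"
proof (rule finite_subset)
  show "(\<lambda>x. x $ k) ` flat k s \<subseteq> insert (outer_level k s) ((\<lambda>j. inner_level j k s) ` {..<m})"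
    unfolding flat_def by auto
qed auto

text \<open>Near \<open>q\<close> the frontier avoids the flats of the other axes, which are closed,
  and the finitely many other levels on axis \<open>k\<close>; what is left lies in one
  plane.\<close>

lemma regularI:
  assumes q: "q \<in> frontier body" and only: "\<And>l s. q \<in> flat l s \<Longrightarrow> l = k"
  shows "q \<in> regular_boundary body"
proof -
  define L where "L = (\<Union>s. (\<lambda>x. x $ k) ` flat k s) - {q $ k}"
  define U where "U = - (\<Union>l\<in>-{k}. \<Union>s. flat l s) \<inter> (\<lambda>x. x $ k) -` (- L)"
  have "finite L" unfolding L_def using finite_levels by auto
  then have "open (- L)" by (simp add: finite_imp_closed open_Compl)
  then have "open ((\<lambda>x::pt. x $ k) -` (- L))"
    by (intro open_vimage) (auto intro!: continuous_intros)
  moreover have "open (- (\<Union>l\<in>-{k}. \<Union>s. flat l s))"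
    by (intro open_Compl closed_UN ballI closed_flat) auto
  ultimately have "open U" unfolding U_def by (intro open_Int)
  moreover have "q \<in> U" using only by (auto simp: U_def L_def)
  moreover have "U \<inter> frontier body \<subseteq> {x. axis k 1 \<bullet> x = q $ k}"
  proof
    fix x assume x: "x \<in> U \<inter> frontier body"
    then obtain l s where ls: "x \<in> flat l s" using frontier_flat by blast
    then have "l = k" using x by (auto simp: U_def)
    then have "x $ k = q $ k" using x ls by (auto simp: U_def L_def)
    then show "x \<in> {x. axis k 1 \<bullet> x = q $ k}" by (simp add: inner_axis')
  qed
  moreover have "axis k (1::real) \<noteq> 0" by (simp add: axis_eq_0_iff)
  ultimately show ?thesis using q unfolding regular_boundary_def by blast
qed

section \<open>Markers forced by pocket sides and by faces of the box\<close>

text \<open>The assumption \<open>only\<close> serves twice: it makes \<open>q\<close> regular, so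
  that a face passes through it, and it forces the normal of that face.\<close>

lemma marker_on_face:
  assumes M: "marker_per_face_markup body M" and q: "q \<in> frontier body"
    and only: "\<And>l s'. q \<in> flat l s' \<Longrightarrow> l = k \<and> s' = s"
  obtains p F where "(p, face_normal k s) \<in> M" "p \<in> F" "q \<in> F" "connected F" "F \<subseteq> flat k s"
    "\<And>x. x \<in> F \<Longrightarrow> x $ k = q $ k"
proof -
  have qr: "q \<in> regular_boundary body" using q only by (intro regularI) blast+
  then obtain C where C: "C \<in> components (regular_boundary body)" "q \<in> C"
    using Union_components by blast
  define F where "F = closure C"
  have "F \<in> poly_faces body" using C by (auto simp: F_def poly_faces_def)
  then obtain p n where pn: "(p, n) \<in> M" "p \<in> F" "outward_normal body F n"
    using M unfolding marker_per_face_markup_def by blast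
  obtain l s' where ls: "n = face_normal l s'" "F \<subseteq> flat l s'" using outward_normal_flat[OF pn(3)] by blast
  have qF: "q \<in> F" using C(2) closure_subset by (auto simp: F_def)
  then have eq: "l = k" "s' = s" using only ls by blast+
  obtain e where e: "F \<subseteq> {x. n \<bullet> x = e}" using pn(3) unfolding outward_normal_def by blast
  have *: "n \<bullet> x = (if s then x $ k else - (x $ k))" for x
    by (simp add: ls eq face_normal_def inner_axis')
  have "x $ k = q $ k" if "x \<in> F" for x
  proof -
    have "n \<bullet> x = n \<bullet> q" using that qF e by auto
    then show ?thesis by (simp add: * split: if_splits)
  qed
  moreover have "connected F" unfolding F_def
    using C in_components_connected connected_imp_connected_closure by blast
  ultimately show thesis using that[of p F] pn ls eq qF by blast
qed

lemma marker_cases: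
  assumes M: "marker_per_face_markup body M" and p: "(p, n) \<in> M"
  obtains k s where "n = face_normal k s" "p \<in> flat k s"
proof -
  obtain F where F: "p \<in> F" "outward_normal body F n"
    using assms unfolding marker_per_face_markup_def by blast
  obtain k s where "n = face_normal k s" "F \<subseteq> flat k s" by (rule outward_normal_flat[OF F(2)])
  then show thesis using F(1) that by blast
qed

lemma flat_level:
  assumes "p \<in> flat k s" "p $ k \<noteq> outer_level k s"
  obtains j where "j < m" "p \<in> cbox (lo j) (hi j)" "p $ k = inner_level j k s"
    "p $ k \<noteq> outer_level k (\<not> s)"
proof -
  have "\<exists>j<m. p \<in> cbox (lo j) (hi j) \<and> p $ k = inner_level j k s \<and> p $ k \<noteq> outer_level k (\<not> s)"
    using assms unfolding flat_def by auto
  then show thesis using that by blast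
qed

lemma flat_subset: "flat k s \<subseteq> cbox a b"
  unfolding flat_def using pocket_subset by blast

text \<open>The face through the centre of the pocket side keeps a level different from the outer
  one, so it is covered by the disjoint closed pockets; being connected, it stays in pocket
  \<open>j\<close>, and so does its marker.\<close>

lemma inner_marker:
  assumes M: "marker_per_face_markup body M" and j: "j < m"
    and lev: "inner_level j k s \<noteq> outer_level k (\<not> s)"
  obtains p where "(p, face_normal k s) \<in> M" "p \<in> cbox (lo j) (hi j)" "p $ k = inner_level j k s"
proof -
  define q where "q = (\<chi> l. if l = k then inner_level j k s else (lo j $ l + hi j $ l) / 2)"
  have qk: "q $ k = inner_level j k s" by (simp add: q_def)
  have ql: "lo j $ l < q $ l \<and> q $ l < hi j $ l" if "l \<noteq> k" for l
    using that pocket[OF j, of l] by (simp add: q_def)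
  have lev': "inner_level j k s \<noteq> outer_level k s"
    using pocket[OF j, of k] by (auto simp: inner_level_def outer_level_def)
  have qK: "q \<in> cbox (lo j) (hi j)"
    unfolding mem_box_cart using pocket[OF j] by (auto simp: q_def inner_level_def less_imp_le)
  have only: "l = k \<and> s' = s" if "q \<in> flat l s'" for l s'
  proof -
    \<comment> \<open>This excludes the outer part of the flat; by disjointness only the sides of
      pocket \<open>j\<close> remain, and the centre lies on just one of them.\<close>
    have "q $ l \<noteq> outer_level l s'"
    proof (cases "l = k")
      case True
      then show ?thesis using qk lev lev' by (cases "s' = s") auto
    next
      case False
      then show ?thesis using ql pocket[OF j, of l] by (auto simp: outer_level_def not_less dest!: spec split: if_splits) (smt (verit))+
    qed
    with that obtain i where i: "i < m" "q \<in> cbox (lo i) (hi i)" "q $ l = inner_level i l s'"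
      by (rule flat_level)
    then have "i = j" using disjoint j qK by blast
    then have "l = k" using i(3) ql by (force simp: inner_level_def split: if_splits)
    then show ?thesis using i(3) \<open>i = j\<close> qk pocket[OF j, of k] by (auto simp: inner_level_def split: if_splits)
  qed
  have "q \<in> frontier body" using inner_frontier[OF j qK qk lev] .
  obtain p F where
    F: "(p, face_normal k s) \<in> M" "p \<in> F" "q \<in> F" "connected F" "F \<subseteq> flat k s"
    "\<And>x. x \<in> F \<Longrightarrow> x $ k = q $ k"
    by (rule marker_on_face[OF M \<open>q \<in> frontier body\<close> only]) (assumption | rule that)+
  have cover: "F \<subseteq> cbox (lo j) (hi j) \<union> (\<Union>i\<in>{..<m} - {j}. cbox (lo i) (hi i))"
  proof
    fix x assume x: "x \<in> F"
    then have "x $ k \<noteq> outer_level k s" using F(6) qk lev' by simp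
    then obtain i where "i < m" "x \<in> cbox (lo i) (hi i)" using x F(5) flat_level by blast
    then show "x \<in> cbox (lo j) (hi j) \<union> (\<Union>i\<in>{..<m} - {j}. cbox (lo i) (hi i))" by blast
  qed
  have "closed (\<Union>i\<in>{..<m} - {j}. cbox (lo i) (hi i))" by (intro closed_UN) auto
  moreover have "cbox (lo j) (hi j) \<inter> (\<Union>i\<in>{..<m} - {j}. cbox (lo i) (hi i)) = {}"
    using disjoint j by blast
  ultimately have "F \<inter> (\<Union>i\<in>{..<m} - {j}. cbox (lo i) (hi i)) = {}"
    using F(3,4) qK cover connected_closedD[of F "cbox (lo j) (hi j)" "\<Union>i\<in>{..<m} - {j}. cbox (lo i) (hi i)"]
    by blast
  with cover F(2) have "p \<in> cbox (lo j) (hi j)" by blast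
  then show thesis using that F qk by auto
qed

lemma outer_marker:
  assumes M: "marker_per_face_markup body M" and q: "q \<in> cbox a b" "q $ k = outer_level k s"
    and in_: "\<And>l. l \<noteq> k \<Longrightarrow> a $ l < q $ l \<and> q $ l < b $ l"
    and nK: "\<And>j. j < m \<Longrightarrow> q \<notin> cbox (lo j) (hi j)"
  obtains p where "(p, face_normal k s) \<in> M" "p $ k = outer_level k s"
proof -
  have "q \<in> cbox a b - (\<Union>j<m. cbox (lo j) (hi j))" using q nK by blast
  then have "q \<in> body" unfolding body_def using closure_subset by (rule subsetD[rotated])
  then have qf: "q \<in> frontier body" using outer_frontier q by blast
  have only: "l = k \<and> s' = s" if "q \<in> flat l s'" for l s'
  proof -
    have "q $ l = outer_level l s'" using that flat_level nK by blast
    then show ?thesis using in_[of l] q(2) box[of k]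
      by (cases "l = k") (auto simp: outer_level_def split: if_splits)
  qed
  obtain p F where "(p, face_normal k s) \<in> M" "p \<in> F" "\<And>x. x \<in> F \<Longrightarrow> x $ k = q $ k"
    by (rule marker_on_face[OF M qf only]) (assumption | rule that)+
  then show thesis using that q by auto
qed

lemma inner_level_cases:
  assumes "j < m"
  shows "inner_level j k s = outer_level k (\<not> s) \<or> a $ k < inner_level j k s \<and> inner_level j k s < b $ k"
  using pocket[OF assms, of k] by (auto simp: inner_level_def outer_level_def)

lemma marker_in_box:
  assumes "marker_per_face_markup body M" "(p, n) \<in> M"
  shows "a $ k \<le> p $ k" "p $ k \<le> b $ k"
proof -
  obtain l s where "p \<in> flat l s" by (rule marker_cases[OF assms])
  then have "p \<in> cbox a b" using flat_subset by blast
  then show "a $ k \<le> p $ k" "p $ k \<le> b $ k" by (auto simp: mem_box_cart)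
qed

lemma inner_marker_pocket:
  assumes M: "marker_per_face_markup body M" "(p, face_normal k s) \<in> M"
    and p: "a $ k < p $ k" "p $ k < b $ k"
  obtains j where "j < m" "p \<in> cbox (lo j) (hi j)" "p $ k = inner_level j k s"
proof -
  obtain l s' where "face_normal k s = face_normal l s'" "p \<in> flat l s'"
    by (rule marker_cases[OF M])
  then have f: "p \<in> flat k s" by (simp add: face_normal_inj)
  moreover have "p $ k \<noteq> outer_level k s" using p by (simp add: outer_level_def)
  ultimately show thesis using flat_level that by metis
qed

end

subsection \<open>Pockets reaching a common face\<close>

text \<open>In \<open>apart\<close> the coordinate \<open>x $ i\<close> is unconstrained: the
  projections of the pockets along axis \<open>i\<close> are disjoint, which is stronger than
  \<open>disjoint\<close>. The alternative in \<open>side\<close> records the end of axis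
  \<open>i\<close> at which all pockets open.\<close>

locale pocketed_box = carved_box +
  fixes i :: 3
  assumes inside: "j < m \<Longrightarrow> k \<noteq> i \<Longrightarrow> a $ k < lo j $ k \<and> hi j $ k < b $ k"
    and side: "(\<forall>j<m. lo j $ i = a $ i) \<or> (\<forall>j<m. hi j $ i = b $ i)"
    and apart: "\<lbrakk>j < m; l < m; \<And>k. k \<noteq> i \<Longrightarrow> lo j $ k \<le> x $ k \<and> x $ k \<le> hi j $ k \<and>
                   lo l $ k \<le> x $ k \<and> x $ k \<le> hi l $ k\<rbrakk> \<Longrightarrow> j = l"
begin

lemma inside_level: "j < m \<Longrightarrow> k \<noteq> i \<Longrightarrow> a $ k < inner_level j k s \<and> inner_level j k s < b $ k"
  using inside[of j k] pocket[of j k] by (auto simp: inner_level_def)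

text \<open>Every face of the box has a point away from all pockets: along an axis \<open>l\<close>
  other than \<open>k\<close> and \<open>i\<close>, the strip next to the lower end is free of
  them.\<close>

lemma outer_level_marker:
  assumes M: "marker_per_face_markup body M"
  obtains p where "(p, face_normal k s) \<in> M" "p $ k = outer_level k s"
proof -
  obtain l where l: "l \<noteq> k" "l \<noteq> i" using third_axis by blast
  \<comment> \<open>The upper end of the strip; inserting \<open>b $ l\<close> gives a value even
    when there are no pockets.\<close>
  define c where "c = Min (insert (b $ l) ((\<lambda>j. lo j $ l) ` {..<m}))"
  have "a $ l < c" unfolding c_def using box inside l by (subst Min_gr_iff) auto
  define q where "q = (\<chi> x. if x = k then outer_level k s else if x = l then (a $ l + c) / 2 else (a $ x + b $ x) / 2)"
  have "c \<le> b $ l" unfolding c_def by (intro Min_le) auto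
  have cl: "c \<le> lo j $ l" if "j < m" for j unfolding c_def using that by (intro Min_le) auto
  have in_: "a $ x < q $ x \<and> q $ x < b $ x" if "x \<noteq> k" for x
    using that \<open>a $ l < c\<close> \<open>c \<le> b $ l\<close> box[of x] by (auto simp: q_def)
  moreover have qk: "q $ k = outer_level k s" by (simp add: q_def)
  moreover have "a $ k \<le> outer_level k s \<and> outer_level k s \<le> b $ k"
    using box[of k] by (auto simp: outer_level_def)
  ultimately have "q \<in> cbox a b" unfolding mem_box_cart by (metis less_imp_le)
  moreover have "q \<notin> cbox (lo j) (hi j)" if "j < m" for j
  proof -
    have "q $ l < lo j $ l" using l \<open>a $ l < c\<close> cl[OF that] by (simp add: q_def)
    then show ?thesis by (auto simp: mem_box_cart not_le intro!: exI[of _ l])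
  qed
  ultimately show thesis using qk in_ that by (metis outer_marker[OF M])
qed

text \<open>For one sign, the pocket sides orthogonal to axis \<open>i\<close> are the openings,
  which lie in the boundary of the box and expose nothing.\<close>

lemma axis_one_sided:
  assumes M: "marker_per_face_markup body M"
  obtains s where "\<And>p. (p, face_normal i s) \<in> M \<Longrightarrow> \<not> (a $ i < p $ i \<and> p $ i < b $ i)"
proof -
  obtain s where s: "\<And>j. j < m \<Longrightarrow> inner_level j i s = outer_level i (\<not> s)"
    using side unfolding inner_level_def outer_level_def by (metis (full_types))
  have "\<not> (a $ i < p $ i \<and> p $ i < b $ i)" if p: "(p, face_normal i s) \<in> M" for p
  proof
    assume "a $ i < p $ i \<and> p $ i < b $ i"
    then obtain j where "j < m" "p $ i = inner_level j i s"
      using inner_marker_pocket[OF M p] by blast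
    with s \<open>a $ i < p $ i \<and> p $ i < b $ i\<close> show False by (auto simp: outer_level_def split: if_splits)
  qed
  then show thesis by (rule that)
qed

definition shadow :: "3 \<Rightarrow> 3 \<Rightarrow> nat \<Rightarrow> rect" where
  "shadow k l j = ((lo j $ k, hi j $ k), (lo j $ l, hi j $ l))"

text \<open>The strict bounds discard markers on the outer faces. The set is determined by
  \<open>M\<close> and the box, so two bodies carved from the same box have the same side
  points.\<close>

definition side_points :: "(pt \<times> pt) set \<Rightarrow> 3 \<Rightarrow> 3 \<Rightarrow> 3 \<Rightarrow> bool \<Rightarrow> (real \<times> real) set" where
  "side_points M k l r s = (\<lambda>p. (p $ k, p $ l)) ` {p. (p, face_normal r s) \<in> M \<and> a $ r < p $ r \<and> p $ r < b $ r}"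

lemma marks_side_points:
  assumes M: "marker_per_face_markup body M" and r: "r \<noteq> i"
    and lev: "\<And>j. lev (shadow k l j) = inner_level j r s" and crd: "\<And>p. crd (p $ k, p $ l) = p $ r"
  shows "marks lev crd (side_points M k l r s) (shadow k l ` {..<m})"
  unfolding marks_def
proof (intro conjI ballI)
  fix w assume "w \<in> side_points M k l r s"
  then obtain p where p: "w = (p $ k, p $ l)" "(p, face_normal r s) \<in> M" "a $ r < p $ r" "p $ r < b $ r"
    unfolding side_points_def by blast
  obtain j where "j < m" "p \<in> cbox (lo j) (hi j)" "p $ r = inner_level j r s"
    by (rule inner_marker_pocket[OF M p(2-4)])
  then show "\<exists>q\<in>shadow k l ` {..<m}. in_rect w q \<and> crd w = lev q"
    using p(1) by (intro bexI[of _ "shadow k l j"]) (simp_all add: lev crd, simp add: mem_box_cart shadow_def)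
next
  fix q assume "q \<in> shadow k l ` {..<m}"
  then obtain j where j: "j < m" "q = shadow k l j" by blast
  have in_: "a $ r < inner_level j r s" "inner_level j r s < b $ r" using inside_level[OF j(1) r] by auto
  then have "inner_level j r s \<noteq> outer_level r (\<not> s)" by (auto simp: outer_level_def)
  then obtain p where p: "(p, face_normal r s) \<in> M" "p \<in> cbox (lo j) (hi j)" "p $ r = inner_level j r s"
    by (rule inner_marker[OF M j(1)])
  then have "(p $ k, p $ l) \<in> side_points M k l r s" using in_ by (auto simp: side_points_def)
  moreover have "in_rect (p $ k, p $ l) q" using p j by (simp add: shadow_def mem_box_cart)
  ultimately show "\<exists>w\<in>side_points M k l r s. in_rect w q \<and> crd w = lev q"
    using p(3) j crd lev by metis
qed

text \<open>The sign \<open>True\<close> goes with the left and bottom sides because a pocket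
  exposes the positive normal on its lower side.\<close>

lemma rect_markup_shadows:
  assumes M: "marker_per_face_markup body M" and kl: "k \<noteq> i" "l \<noteq> i" "k \<noteq> l"
  shows "rect_markup (side_points M k l k True) (side_points M k l k False)
     (side_points M k l l True) (side_points M k l l False) (shadow k l ` {..<m})"
  unfolding rect_markup_def
proof (intro conjI marks_side_points[OF M kl(1)] marks_side_points[OF M kl(2)] ballI impI notI)
  fix q r assume qr: "q \<in> shadow k l ` {..<m}" "r \<in> shadow k l ` {..<m}" "q \<noteq> r"
    "\<exists>w. in_rect w q \<and> in_rect w r"
  then obtain j h x y where j: "j < m" "h < m" "q = shadow k l j" "r = shadow k l h"
    "in_rect (x, y) q" "in_rect (x, y) r" by auto
  \<comment> \<open>A lift of the common planar point; its coordinate \<open>i\<close> is arbitrary,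
    as \<open>apart\<close> permits.\<close>
  define z :: pt where "z = (\<chi> c. if c = k then x else y)"
  have "j = h"
  proof (rule apart[OF j(1,2), of z])
    fix c assume "c \<noteq> i"
    then show "lo j $ c \<le> z $ c \<and> z $ c \<le> hi j $ c \<and> lo h $ c \<le> z $ c \<and> z $ c \<le> hi h $ c"
      using other_axes_cases[OF kl \<open>c \<noteq> i\<close>] kl j by (auto simp: z_def shadow_def)
  qed
  with j qr show False by simp
qed (auto simp: shadow_def inner_level_def)

end

section \<open>Comparing two bodies with a common markup\<close>

text \<open>Each outer level of the first box is attained by a marker, and every marker lies in the
  second box.\<close>

lemma box_le:
  assumes "pocketed_box a b m lo hi i" "pocketed_box a' b' m' lo' hi' i'"
    and "marker_per_face_markup (carved_box.body a b m lo hi) M"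
    and "marker_per_face_markup (carved_box.body a' b' m' lo' hi') M"
  shows "a' $ k \<le> a $ k" "b $ k \<le> b' $ k"
proof -
  interpret X: pocketed_box a b m lo hi i by fact
  interpret Y: pocketed_box a' b' m' lo' hi' i' by fact
  have *: "a' $ k \<le> X.outer_level k s \<and> X.outer_level k s \<le> b' $ k" for s
  proof -
    obtain p where "(p, face_normal k s) \<in> M" "p $ k = X.outer_level k s"
      by (rule X.outer_level_marker[OF assms(3)])
    then show ?thesis using Y.marker_in_box[OF assms(4), of p "face_normal k s" k] by simp
  qed
  show "a' $ k \<le> a $ k" "b $ k \<le> b' $ k"
    using *[of False] *[of True] by (simp_all add: X.outer_level_def)
qed

text \<open>On an axis other than \<open>i\<close>, pocket \<open>j\<close> forces intermediate
  markers of both signs, whereas the second body admits none of one sign on its axis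
  \<open>i'\<close>.\<close>

lemma same_axis:
  assumes "pocketed_box a b m lo hi i" "pocketed_box a b m' lo' hi' i'"
    and M: "marker_per_face_markup (carved_box.body a b m lo hi) M"
    and M': "marker_per_face_markup (carved_box.body a b m' lo' hi') M"
    and j: "j < m"
  shows "i' = i"
proof (rule ccontr)
  assume ne: "i' \<noteq> i"
  interpret X: pocketed_box a b m lo hi i by fact
  interpret Y: pocketed_box a b m' lo' hi' i' by fact
  obtain s where s: "\<And>p. (p, face_normal i' s) \<in> M \<Longrightarrow> \<not> (a $ i' < p $ i' \<and> p $ i' < b $ i')"
    by (rule Y.axis_one_sided[OF M']) (rule that)
  have in_: "a $ i' < X.inner_level j i' s" "X.inner_level j i' s < b $ i'"
    using X.inside_level[OF j ne] by auto
  then have "X.inner_level j i' s \<noteq> X.outer_level i' (\<not> s)" by (auto simp: X.outer_level_def)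
  then obtain p where "(p, face_normal i' s) \<in> M" "p $ i' = X.inner_level j i' s"
    by (rule X.inner_marker[OF M j])
  with s in_ show False by metis
qed

text \<open>The floor marker of pocket \<open>j\<close> lies on some pocket \<open>h\<close> of the
  second body; its projection lies in the projections of both \<open>h\<close> and \<open>l\<close>,
  so \<open>h = l\<close>.\<close>

lemma same_level:
  assumes "pocketed_box a b m lo hi i" "pocketed_box a b m' lo' hi' i"
    and M: "marker_per_face_markup (carved_box.body a b m lo hi) M"
    and M': "marker_per_face_markup (carved_box.body a b m' lo' hi') M"
    and j: "j < m" and l: "l < m'"
    and eq: "\<And>k. k \<noteq> i \<Longrightarrow> lo j $ k = lo' l $ k \<and> hi j $ k = hi' l $ k"
    and in_: "a $ i < carved_box.inner_level lo hi j i s" "carved_box.inner_level lo hi j i s < b $ i"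
  shows "carved_box.inner_level lo hi j i s = carved_box.inner_level lo' hi' l i s"
proof -
  interpret X: pocketed_box a b m lo hi i by fact
  interpret Y: pocketed_box a b m' lo' hi' i by fact
  have "X.inner_level j i s \<noteq> X.outer_level i (\<not> s)" using in_ by (auto simp: X.outer_level_def)
  then obtain p where p: "(p, face_normal i s) \<in> M" "p \<in> cbox (lo j) (hi j)" "p $ i = X.inner_level j i s"
    by (rule X.inner_marker[OF M j])
  then obtain h where h: "h < m'" "p \<in> cbox (lo' h) (hi' h)" "p $ i = Y.inner_level h i s"
    using Y.inner_marker_pocket[OF M' p(1)] in_ by metis
  have "h = l"
  proof (rule Y.apart[OF h(1) l, of p])
    fix k assume "k \<noteq> i"
    then show "lo' h $ k \<le> p $ k \<and> p $ k \<le> hi' h $ k \<and> lo' l $ k \<le> p $ k \<and> p $ k \<le> hi' l $ k"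
      using p(2) h(2) eq[of k] by (metis mem_box_cart)
  qed
  with h p show ?thesis by simp
qed

lemma same_pockets:
  assumes X: "pocketed_box a b m lo hi i" and Y: "pocketed_box a b m' lo' hi' i'"
    and "finite M"
    and M: "marker_per_face_markup (carved_box.body a b m lo hi) M"
    and M': "marker_per_face_markup (carved_box.body a b m' lo' hi') M"
    and j: "j < m"
  obtains l where "l < m'" "lo j = lo' l" "hi j = hi' l"
proof -
  have "i' = i" by (rule same_axis[OF X Y M M' j])
  with Y have Y: "pocketed_box a b m' lo' hi' i" by simp
  interpret X: pocketed_box a b m lo hi i by fact
  interpret Y: pocketed_box a b m' lo' hi' i by fact
  obtain k k' :: 3 where k: "k \<noteq> i" "k' \<noteq> i" "k \<noteq> k'"
    using third_axis by metis
  have "finite (X.side_points M k k' k True)"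
    unfolding X.side_points_def
    by (rule finite_imageI, rule finite_subset[OF _ finite_imageI[OF \<open>finite M\<close>, of fst]]) force
  then have "X.shadow k k' ` {..<m} \<subseteq> Y.shadow k k' ` {..<m'}"
    using rect_markup_subset[OF X.rect_markup_shadows[OF M k] Y.rect_markup_shadows[OF M' k]] by blast
  then obtain l where l: "l < m'" "X.shadow k k' j = Y.shadow k k' l" using j by blast
  have eq: "lo j $ c = lo' l $ c \<and> hi j $ c = hi' l $ c" if "c \<noteq> i" for c
    using l(2) other_axes_cases[OF k that] by (auto simp: X.shadow_def Y.shadow_def)
  \<comment> \<open>If either level is intermediate, its marker transfers it to the other body;
    otherwise both are the outer level. This also covers pockets that go all the way
    through.\<close>
  have "X.inner_level j i s = Y.inner_level l i s" for s
    using X.inner_level_cases[OF j, of i s] Y.inner_level_cases[OF l(1), of i s]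
      same_level[OF X Y M M' j l(1), of s] same_level[OF Y X M' M l(1) j, of s] eq by metis
  from this[of True] this[of False] eq have "lo j = lo' l" "hi j = hi' l"
    by (auto simp: X.inner_level_def Y.inner_level_def vec_eq_iff) metis+
  with l show thesis using that by blast
qed

section \<open>From intrusions in a face to pocketed boxes\<close>

lemma intrusion_eq_cbox:
  fixes a b :: pt
  shows "intrusion a b i s c d e =
    cbox (\<chi> k. if k = i then (if s then b $ i - e else a $ i) else c $ k)
         (\<chi> k. if k = i then (if s then b $ i else a $ i + e) else d $ k)" (is "_ = cbox ?l ?h")
proof (intro equalityI subsetI)
  fix x assume "x \<in> intrusion a b i s c d e"
  then show "x \<in> cbox ?l ?h"
    unfolding intrusion_def face_rect_def face_level_def
    by (auto simp: mem_box_cart face_normal_nth split: if_splits)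
next
  fix x assume x: "x \<in> cbox ?l ?h"
  define t where "t = (if s then b $ i - x $ i else x $ i - a $ i)"
  have xi: "?l $ k \<le> x $ k \<and> x $ k \<le> ?h $ k" for k using x by (simp add: mem_box_cart)
  have "0 \<le> t \<and> t \<le> e" using xi[of i] by (auto simp: t_def split: if_splits)
  moreover have "x + t *\<^sub>R face_normal i s \<in> face_rect a b i s c d"
  proof -
    have "c $ k \<le> x $ k \<and> x $ k \<le> d $ k" if "k \<noteq> i" for k using xi[of k] that by simp
    then show ?thesis unfolding face_rect_def by (simp add: face_level_def face_normal_nth t_def)
  qed
  moreover have "x = (x + t *\<^sub>R face_normal i s) - t *\<^sub>R face_normal i s" by simp
  ultimately show "x \<in> intrusion a b i s c d e" unfolding intrusion_def by blast
qed

lemma intrusion_polyhedron_pocketed_box: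
  assumes "intrusion_polyhedron P"
  obtains a b m lo hi i where "pocketed_box a b m lo hi i" "P = carved_box.body a b m lo hi"
proof -
  from assms obtain a b i s c d and m :: nat and dep where
    ab: "\<forall>k. a $ k < b $ k" and
    pk: "\<forall>j<m. 0 < dep j \<and> dep j \<le> b $ i - a $ i \<and>
        (\<forall>k. k \<noteq> i \<longrightarrow> a $ k < c j $ k \<and> c j $ k < d j $ k \<and> d j $ k < b $ k)" and
    disj: "\<forall>j<m. \<forall>l<m. j \<noteq> l \<longrightarrow>
        face_rect a b i s (c j) (d j) \<inter> face_rect a b i s (c l) (d l) = {}" and
    P: "P = closure (cbox a b - (\<Union>j<m. intrusion a b i s (c j) (d j) (dep j)))"
    unfolding intrusion_polyhedron_def by (elim exE conjE) (rule that)
  define lo :: "nat \<Rightarrow> pt" where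
    "lo j = (\<chi> k. if k = i then (if s then b $ i - dep j else a $ i) else c j $ k)" for j
  define hi :: "nat \<Rightarrow> pt" where
    "hi j = (\<chi> k. if k = i then (if s then b $ i else a $ i + dep j) else d j $ k)" for j
  have apart: "j = l" if "j < m" "l < m" and x: "\<And>k. k \<noteq> i \<Longrightarrow> lo j $ k \<le> x $ k \<and> x $ k \<le> hi j $ k \<and>
        lo l $ k \<le> x $ k \<and> x $ k \<le> hi l $ k" for j l x
  proof (rule ccontr)
    assume "j \<noteq> l"
    \<comment> \<open>Sliding \<open>x\<close> along axis \<open>i\<close> into the face yields a
      common point of the two face rectangles.\<close>
    define y where "y = (\<chi> k. if k = i then face_level a b i s else x $ k)"
    have "y \<in> face_rect a b i s (c j) (d j) \<inter> face_rect a b i s (c l) (d l)"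
      using x by (auto simp: y_def face_rect_def lo_def hi_def)
    with disj that(1,2) \<open>j \<noteq> l\<close> show False by blast
  qed
  interpret carved_box a b m lo hi
  proof
    show "a $ k < b $ k" for k using ab by blast
    show "a $ k \<le> lo j $ k \<and> lo j $ k < hi j $ k \<and> hi j $ k \<le> b $ k" if "j < m" for j k
      using pk that spec[OF ab, of k] by (cases "k = i") (force simp: lo_def hi_def)+
    show "j = l" if "j < m" "l < m" "x \<in> cbox (lo j) (hi j)" "x \<in> cbox (lo l) (hi l)" for j l x
      using that by (intro apart[of j l x]) (auto simp: mem_box_cart)
  qed
  interpret pocketed_box a b m lo hi i
  proof
    show "a $ k < lo j $ k \<and> hi j $ k < b $ k" if "j < m" "k \<noteq> i" for j k
      using pk that by (simp add: lo_def hi_def)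
    show "(\<forall>j<m. lo j $ i = a $ i) \<or> (\<forall>j<m. hi j $ i = b $ i)"
      by (cases s) (simp_all add: lo_def hi_def)
    show "j = l" if "j < m" "l < m" "\<And>k. k \<noteq> i \<Longrightarrow> lo j $ k \<le> x $ k \<and> x $ k \<le> hi j $ k \<and>
                   lo l $ k \<le> x $ k \<and> x $ k \<le> hi l $ k" for j l x
      using that by (rule apart)
  qed
  have "P = body" unfolding P body_def intrusion_eq_cbox lo_def hi_def ..
  with pocketed_box_axioms show thesis by (rule that)
qed

theorem mainTheorem6:
  fixes P P' :: "(real^3) set" and M :: "((real^3) \<times> (real^3)) set"
  assumes "intrusion_polyhedron P" and "intrusion_polyhedron P'"
    and "finite M"
    and "marker_per_face_markup P M" and "marker_per_face_markup P' M"
  shows "P = P'"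
proof -
  obtain a b m lo hi i where X: "pocketed_box a b m lo hi i" and P: "P = carved_box.body a b m lo hi"
    by (rule intrusion_polyhedron_pocketed_box[OF assms(1)])
  obtain a' b' m' lo' hi' i' where Y: "pocketed_box a' b' m' lo' hi' i'"
    and P': "P' = carved_box.body a' b' m' lo' hi'"
    by (rule intrusion_polyhedron_pocketed_box[OF assms(2)])
  note M = assms(4)[unfolded P] and M' = assms(5)[unfolded P']
  have "a' = a" "b' = b"
    using box_le[OF X Y M M'] box_le[OF Y X M' M] by (auto simp: vec_eq_iff intro: antisym)
  note Y = Y[unfolded this] and M' = M'[unfolded this] and P' = P'[unfolded this]
  have "(\<Union>j<m. cbox (lo j) (hi j)) = (\<Union>j<m'. cbox (lo' j) (hi' j))"
  proof (intro equalityI UN_least)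
    fix j assume "j \<in> {..<m}"
    then obtain l where "l < m'" "lo j = lo' l" "hi j = hi' l"
      using same_pockets[OF X Y \<open>finite M\<close> M M'] by blast
    then show "cbox (lo j) (hi j) \<subseteq> (\<Union>j<m'. cbox (lo' j) (hi' j))" by auto
  next
    fix j assume "j \<in> {..<m'}"
    then obtain l where "l < m" "lo' j = lo l" "hi' j = hi l"
      using same_pockets[OF Y X \<open>finite M\<close> M' M] by blast
    then show "cbox (lo' j) (hi' j) \<subseteq> (\<Union>j<m. cbox (lo j) (hi j))" by auto
  qed
  moreover have "carved_box a b m lo hi" "carved_box a b m' lo' hi'"
    using X Y by (simp_all add: pocketed_box_def)
  ultimately show ?thesis by (simp add: P P' carved_box.body_def)
qed

end
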